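(* Let $\alpha>0$, $n>0$, $\kappa>0$, $\theta_0\in\mathbb{R}$, $c_0=e^{\alpha\theta_0}$, and $\sigma_s(t)=\frac{1}{\alpha t+c_0}$. Consider solutions $(\bar u,\bar\theta)(x,t)$, for $x\in[0,1]$ and $t\ge0$, of $$ \bar u_t=\sigma_s(t)\,\big(n\bar u_{xx}-\alpha\bar\theta_{xx}\big),\qquad \bar\theta_t-\kappa\bar\theta_{xx}=\sigma_s(t)\,\big((n+1)\bar u-\alpha\bar\theta\big), $$ with boundary conditions $\bar u_x(0,t)=\bar u_x(1,t)=0$ and $\bar\theta_x(0,t)=\bar\theta_x(1,t)=0$, that satisfy $\int_0^1\bar u(x,t)\,dx=0$ for all $t\ge 0$. Then there exist $B>0$ and a constant $C_B>0$ such that $$ \int_0^1\Big(\tfrac12\bar u^2+\tfrac B2\bar\theta^2\Big)(x,t)\,dx\le\left(\int_0^1\Big(\tfrac12\bar u^2+\tfrac B2\bar\theta^2\Big)(x,0)\,dx\right)e^{C_Bt}\qquad\text{for } t\ge0 . $$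
   Context: Subscripts $t$ and $x$ denote partial derivatives. Solutions are understood to be classical (sufficiently smooth on $[0,1]\times[0,\infty)$). The constants $B$ and $C_B$ depend only on the parameters $\alpha,n,\kappa,c_0$ and not on the particular solution. *)

theory Defs
  imports "HOL-Analysis.Analysis"
begin

text \<open>A function of \<open>(x, t)\<close> is represented as \<open>f :: real \<Rightarrow> real \<Rightarrow> real\<close>; only its values on
  \<open>[0,1] \<times> [0,\<infinity>)\<close> matter. Partial derivatives are taken relative to that strip, so they are
  one-sided at \<open>x = 0\<close>, \<open>x = 1\<close> and \<open>t = 0\<close>.\<close>

definition strip :: "(real \<times> real) set" where
  "strip = {0..1} \<times> {0..}"

definition partial_x :: "(real \<Rightarrow> real \<Rightarrow> real) \<Rightarrow> real \<Rightarrow> real \<Rightarrow> real" where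
  "partial_x f x t = vector_derivative (\<lambda>y. f y t) (at x within {0..1})"

definition partial_t :: "(real \<Rightarrow> real \<Rightarrow> real) \<Rightarrow> real \<Rightarrow> real \<Rightarrow> real" where
  "partial_t f x t = vector_derivative (\<lambda>s. f x s) (at t within {0..})"

text \<open>Regularity of a classical solution of a second-order parabolic equation: class
  \<open>C\<^sup>2\<close> in \<open>x\<close> and \<open>C\<^sup>1\<close> in \<open>t\<close>, up to the boundary of the strip. The differentiability clauses
  are needed because \<open>vector_derivative\<close> is total.\<close>

definition classical_regularity :: "(real \<Rightarrow> real \<Rightarrow> real) \<Rightarrow> bool" where
  "classical_regularity f \<longleftrightarrow>
     (\<forall>(x, t) \<in> strip.
        (\<lambda>s. f x s) differentiable (at t within {0..}) \<and>
        (\<lambda>y. f y t) differentiable (at x within {0..1}) \<and>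
        (\<lambda>y. partial_x f y t) differentiable (at x within {0..1})) \<and>
     continuous_on strip (\<lambda>(x, t). f x t) \<and>
     continuous_on strip (\<lambda>(x, t). partial_t f x t) \<and>
     continuous_on strip (\<lambda>(x, t). partial_x f x t) \<and>
     continuous_on strip (\<lambda>(x, t). partial_x (partial_x f) x t)"

definition sigma_s :: "real \<Rightarrow> real \<Rightarrow> real \<Rightarrow> real" where
  "sigma_s \<alpha> c\<^sub>0 t = 1 / (\<alpha> * t + c\<^sub>0)"

definition is_solution ::
  "real \<Rightarrow> real \<Rightarrow> real \<Rightarrow> real \<Rightarrow> (real \<Rightarrow> real \<Rightarrow> real) \<Rightarrow> (real \<Rightarrow> real \<Rightarrow> real) \<Rightarrow> bool" where
  "is_solution \<alpha> n \<kappa> c\<^sub>0 u \<theta> \<longleftrightarrow>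
     classical_regularity u \<and> classical_regularity \<theta> \<and>
     (\<forall>(x, t) \<in> strip.
        partial_t u x t =
          sigma_s \<alpha> c\<^sub>0 t * (n * partial_x (partial_x u) x t - \<alpha> * partial_x (partial_x \<theta>) x t) \<and>
        partial_t \<theta> x t - \<kappa> * partial_x (partial_x \<theta>) x t =
          sigma_s \<alpha> c\<^sub>0 t * ((n + 1) * u x t - \<alpha> * \<theta> x t)) \<and>
     (\<forall>t\<ge>0. partial_x u 0 t = 0 \<and> partial_x u 1 t = 0 \<and>
             partial_x \<theta> 0 t = 0 \<and> partial_x \<theta> 1 t = 0)"

end

theory Submission
  imports Defs
begin

text \<open>Testing the first equation with \<open>u\<close> and the second with \<open>B * \<theta>\<close> and integrating by parts, the
  Neumann conditions kill the boundary terms and leave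
  \<open>- \<sigma> n u\<^sub>x\<^sup>2 + \<sigma> \<alpha> u\<^sub>x \<theta>\<^sub>x - B \<kappa> \<theta>\<^sub>x\<^sup>2 + B \<sigma> ((n + 1) u \<theta> - \<alpha> \<theta>\<^sup>2)\<close> under the integral. Since
  \<open>\<sigma> \<le> 1 / c\<^sub>0\<close>, the quadratic form in \<open>(u\<^sub>x, \<theta>\<^sub>x)\<close> is nonpositive once \<open>4 n \<kappa> c\<^sub>0 B \<ge> \<alpha>\<^sup>2\<close>; the remaining
  cross term is bounded by a multiple of the energy, and Gronwall's inequality concludes.\<close>

text \<open>The integrating factor \<open>exp (- C * s)\<close> turns the differential inequality
  into a sign condition: the derivative \<open>g'\<close> of \<open>g\<close> is nonpositive, so the
  mean value theorem on \<open>{0..t}\<close> gives \<open>g t\<close> \<le>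
  \<open>g 0\<close>.\<close>

lemma gronwall_differential:
  fixes E E' :: "real \<Rightarrow> real"
  assumes deriv: "\<And>t. t \<ge> 0 \<Longrightarrow> (E has_real_derivative E' t) (at t within {0..})"
    and bound: "\<And>t. t \<ge> 0 \<Longrightarrow> E' t \<le> C * E t"
    and "t \<ge> 0"
  shows "E t \<le> E 0 * exp (C * t)"
proof -
  define g where "g s = E s * exp (- C * s)" for s
  define g' where "g' s = (E' s - C * E s) * exp (- C * s)" for s
  have "(g has_derivative (\<lambda>h. g' s * h)) (at s within {0..t})" if "0 \<le> s" "s \<le> t" for s
  proof -
    have "(E has_real_derivative E' s) (at s within {0..t})"
      by (rule DERIV_subset[OF deriv]) (use that in auto)
    then have "(g has_real_derivative g' s) (at s within {0..t})"
      unfolding g_def g'_def by (auto intro!: derivative_eq_intros simp: algebra_simps)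
    then show ?thesis
      by (simp add: has_field_derivative_def)
  qed
  from mvt_very_simple[OF \<open>t \<ge> 0\<close> this]
  obtain s where s: "s \<in> {0..t}" "g t - g 0 = g' s * (t - 0)"
    by auto
  have "g' s \<le> 0"
    unfolding g'_def using bound[of s] s(1) by (simp add: mult_nonpos_nonneg)
  then have "g' s * (t - 0) \<le> 0"
    using \<open>t \<ge> 0\<close> by (simp add: mult_nonpos_nonneg)
  with s(2) have "g t \<le> g 0"
    by linarith
  then have "E t * exp (- C * t) * exp (C * t) \<le> E 0 * exp (C * t)"
    by (simp add: g_def)
  then show ?thesis
    by (simp add: mult.assoc flip: exp_add)
qed

text \<open>Pointwise core of the energy method, with \<open>w\<close>, \<open>p\<close>,
  \<open>q\<close>, \<open>s\<close> standing for \<theta>, the x-derivatives of u and \<theta>, and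
  the weight \<open>sigma_s\<close>. The gradient terms are handled by completing the square in
  \<open>p\<close>, the product \<open>u * w\<close> by Young's inequality.\<close>

lemma energy_density_estimate:
  fixes u w p q :: real
  assumes "\<alpha> > 0" "n > 0" "c > 0" "0 \<le> s" "s \<le> 1 / c"
    and B: "B > 0" "\<alpha>\<^sup>2 / (4 * n * c) \<le> B * \<kappa>"
  shows "- s * n * p\<^sup>2 + s * \<alpha> * p * q - B * \<kappa> * q\<^sup>2 + B * s * ((n + 1) * u - \<alpha> * w) * w
    \<le> (B + 1) * (n + 1) / c * (1 / 2 * u\<^sup>2 + B / 2 * w\<^sup>2)"
proof -
  \<comment> \<open>Completing the square in \<open>p\<close> costs
    \<open>s * (\<alpha>\<^sup>2 / (4 * n)) * q\<^sup>2\<close>. The assumption on \<open>B\<close>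
    lets the diffusion of \<theta> absorb this cost at the largest admissible weight,
    \<open>s = 1 / c\<close>.\<close>
  have "s * (\<alpha>\<^sup>2 / (4 * n)) \<le> (1 / c) * (\<alpha>\<^sup>2 / (4 * n))"
    using assms by (intro mult_right_mono) auto
  also have "\<dots> = \<alpha>\<^sup>2 / (4 * n * c)"
    by simp
  finally have "s * (\<alpha>\<^sup>2 / (4 * n)) \<le> B * \<kappa>"
    using B(2) by simp
  then have "s * (\<alpha>\<^sup>2 / (4 * n)) * q\<^sup>2 \<le> B * \<kappa> * q\<^sup>2"
    by (intro mult_right_mono) auto
  moreover have "s * n * p\<^sup>2 - s * \<alpha> * p * q + s * (\<alpha>\<^sup>2 / (4 * n)) * q\<^sup>2
      = s * n * (p - \<alpha> / (2 * n) * q)\<^sup>2"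
    using assms by (simp add: field_simps power2_eq_square)
  moreover have "0 \<le> s * n * (p - \<alpha> / (2 * n) * q)\<^sup>2"
    using assms by simp
  ultimately have form: "- s * n * p\<^sup>2 + s * \<alpha> * p * q - B * \<kappa> * q\<^sup>2 \<le> 0"
    by linarith
  have "0 \<le> (u - w)\<^sup>2"
    by simp
  then have "2 * (u * w) \<le> u\<^sup>2 + w\<^sup>2"
    by (simp add: power2_eq_square algebra_simps)
  then have "B * (u * w) \<le> B * (1 / 2 * u\<^sup>2 + 1 / 2 * w\<^sup>2)"
    using B by (intro mult_left_mono) auto
  \<comment> \<open>The added squares are chosen so that the sum factors as \<open>B + 1\<close>
    times the energy density.\<close>
  also have "\<dots> \<le> B * (1 / 2 * u\<^sup>2 + 1 / 2 * w\<^sup>2) + (1 / 2 * u\<^sup>2 + B\<^sup>2 / 2 * w\<^sup>2)"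
    by simp
  also have "\<dots> = (B + 1) * (1 / 2 * u\<^sup>2 + B / 2 * w\<^sup>2)"
    by (simp add: field_simps power2_eq_square)
  finally have cross: "B * (u * w) \<le> (B + 1) * (1 / 2 * u\<^sup>2 + B / 2 * w\<^sup>2)" .
  \<comment> \<open>The zeroth-order damping of \<theta> has the favourable sign and is
    dropped.\<close>
  have "0 \<le> B * s * \<alpha> * w\<^sup>2"
    using assms by simp
  then have "B * s * ((n + 1) * u - \<alpha> * w) * w \<le> s * (n + 1) * (B * (u * w))"
    by (simp add: power2_eq_square algebra_simps)
  also have "\<dots> \<le> s * (n + 1) * ((B + 1) * (1 / 2 * u\<^sup>2 + B / 2 * w\<^sup>2))"
    using assms cross by (intro mult_left_mono) auto
  also have "\<dots> \<le> 1 / c * (n + 1) * ((B + 1) * (1 / 2 * u\<^sup>2 + B / 2 * w\<^sup>2))"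
    using assms by (intro mult_right_mono) auto
  finally show ?thesis
    using form by (simp add: mult_ac)
qed

lemma classical_regularity_derivs:
  assumes "classical_regularity f" "x \<in> {0..1}" "t \<ge> 0"
  shows "((\<lambda>s. f x s) has_real_derivative partial_t f x t) (at t within {0..})"
    and "((\<lambda>y. f y t) has_real_derivative partial_x f x t) (at x within {0..1})"
    and "((\<lambda>y. partial_x f y t) has_real_derivative partial_x (partial_x f) x t)
      (at x within {0..1})"
  using assms
  unfolding classical_regularity_def strip_def partial_t_def partial_x_def
    has_real_derivative_iff_has_vector_derivative
  by (fastforce simp: vector_derivative_works)+

text \<open>The Leibniz rule expects the parameter \<open>t\<close> as first coordinate, while
  \<open>strip\<close> lists \<open>x\<close> first.\<close>

lemma continuous_on_strip_swap:
  assumes "continuous_on strip (\<lambda>(x, t). f x t)"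
  shows "continuous_on ({0..} \<times> {0..1}) (\<lambda>(t, x). f x t)"
proof -
  have "continuous_on ({0..} \<times> {0..1}) ((\<lambda>(x, t). f x t) \<circ> prod.swap)"
    by (rule continuous_on_compose)
      (use assms in \<open>auto simp: strip_def product_swap intro: continuous_on_swap\<close>)
  then show ?thesis
    by (simp add: case_prod_unfold comp_def)
qed

lemma continuous_on_strip_slice:
  assumes "continuous_on strip (\<lambda>(x, t). f x t)" "t \<ge> 0"
  shows "continuous_on {0..1} (\<lambda>x. f x t)"
proof -
  have "continuous_on {0..1} ((\<lambda>(x, t). f x t) \<circ> (\<lambda>x. (x, t)))"
    by (intro continuous_on_compose continuous_intros continuous_on_subset[OF assms(1)])
      (use assms(2) in \<open>auto simp: strip_def\<close>)
  then show ?thesis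
    by (simp add: comp_def)
qed

text \<open>Differentiation under the integral sign: the t-derivative of the density is jointly
  continuous up to the boundary of the strip. The derivative is one-sided at
  \<open>t = 0\<close>.\<close>

lemma energy_has_derivative:
  assumes u: "classical_regularity u" and \<theta>: "classical_regularity \<theta>" and "t \<ge> 0"
  shows "((\<lambda>t. integral {0..1} (\<lambda>x. 1 / 2 * (u x t)\<^sup>2 + B / 2 * (\<theta> x t)\<^sup>2)) has_real_derivative
      integral {0..1} (\<lambda>x. u x t * partial_t u x t + B * \<theta> x t * partial_t \<theta> x t))
    (at t within {0..})"
proof -
  have "((\<lambda>t. integral (cbox 0 1) (\<lambda>x. 1 / 2 * (u x t)\<^sup>2 + B / 2 * (\<theta> x t)\<^sup>2)) has_real_derivative
      integral (cbox 0 1) (\<lambda>x. u x t * partial_t u x t + B * \<theta> x t * partial_t \<theta> x t))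
    (at t within {0..})"
  proof (rule leibniz_rule_field_derivative)
    fix s x :: real assume "s \<in> {0..}" "x \<in> cbox 0 1"
    then have "x \<in> {0..1}" "s \<ge> 0"
      by auto
    note [derivative_intros] = classical_regularity_derivs(1)[OF u this]
      classical_regularity_derivs(1)[OF \<theta> this]
    show "((\<lambda>s. 1 / 2 * (u x s)\<^sup>2 + B / 2 * (\<theta> x s)\<^sup>2) has_real_derivative
        u x s * partial_t u x s + B * \<theta> x s * partial_t \<theta> x s) (at s within {0..})"
      by (auto intro!: derivative_eq_intros)
  next
    fix s :: real assume "s \<in> {0..}"
    then have "continuous_on {0..1} (\<lambda>x. u x s)" "continuous_on {0..1} (\<lambda>x. \<theta> x s)"
      using u \<theta> by (auto simp: classical_regularity_def intro: continuous_on_strip_slice)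
    then show "(\<lambda>x. 1 / 2 * (u x s)\<^sup>2 + B / 2 * (\<theta> x s)\<^sup>2) integrable_on cbox 0 1"
      unfolding cbox_interval
      by (intro integrable_continuous_real continuous_intros)
  next
    have "continuous_on ({0..} \<times> {0..1}) (\<lambda>(t, x). u x t)"
      "continuous_on ({0..} \<times> {0..1}) (\<lambda>(t, x). \<theta> x t)"
      "continuous_on ({0..} \<times> {0..1}) (\<lambda>(t, x). partial_t u x t)"
      "continuous_on ({0..} \<times> {0..1}) (\<lambda>(t, x). partial_t \<theta> x t)"
      using u \<theta> by (auto simp: classical_regularity_def intro: continuous_on_strip_swap)
    then show "continuous_on ({0..} \<times> cbox 0 1)
        (\<lambda>(t, x). u x t * partial_t u x t + B * \<theta> x t * partial_t \<theta> x t)"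
      unfolding cbox_interval case_prod_unfold by (intro continuous_intros)
  qed (use \<open>t \<ge> 0\<close> in auto)
  then show ?thesis
    by simp
qed

lemma energy_derivative_bound:
  assumes pos: "\<alpha> > 0" "n > 0" "c > 0"
    and B: "B > 0" "\<alpha>\<^sup>2 / (4 * n * c) \<le> B * \<kappa>"
    and sol: "is_solution \<alpha> n \<kappa> c u \<theta>" and "t \<ge> 0"
  shows "integral {0..1} (\<lambda>x. u x t * partial_t u x t + B * \<theta> x t * partial_t \<theta> x t)
    \<le> (B + 1) * (n + 1) / c * integral {0..1} (\<lambda>x. 1 / 2 * (u x t)\<^sup>2 + B / 2 * (\<theta> x t)\<^sup>2)"
proof -
  define s where "s = sigma_s \<alpha> c t"
  have s: "0 \<le> s" "s \<le> 1 / c"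
    unfolding s_def sigma_s_def using pos \<open>t \<ge> 0\<close> by (auto intro!: frac_le)
  have reg: "classical_regularity u" "classical_regularity \<theta>"
    using sol by (auto simp: is_solution_def)
  have cont: "continuous_on {0..1} (\<lambda>x. u x t)" "continuous_on {0..1} (\<lambda>x. \<theta> x t)"
    "continuous_on {0..1} (\<lambda>x. partial_t u x t)" "continuous_on {0..1} (\<lambda>x. partial_t \<theta> x t)"
    using reg \<open>t \<ge> 0\<close> by (auto simp: classical_regularity_def intro: continuous_on_strip_slice)
  \<comment> \<open>The flux collects all boundary terms of the integrations by parts.\<close>
  define F where "F x = s * n * (u x t * partial_x u x t) - s * \<alpha> * (u x t * partial_x \<theta> x t)
    + B * \<kappa> * (\<theta> x t * partial_x \<theta> x t)" for x
  define F' where "F' x =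
    s * n * ((partial_x u x t)\<^sup>2 + u x t * partial_x (partial_x u) x t)
    - s * \<alpha> * (partial_x u x t * partial_x \<theta> x t + u x t * partial_x (partial_x \<theta>) x t)
    + B * \<kappa> * ((partial_x \<theta> x t)\<^sup>2 + \<theta> x t * partial_x (partial_x \<theta>) x t)" for x
  have "(F has_vector_derivative F' x) (at x within {0..1})" if "x \<in> {0..1}" for x
  proof -
    note [derivative_intros] = classical_regularity_derivs(2,3)[OF reg(1) that \<open>t \<ge> 0\<close>]
      classical_regularity_derivs(2,3)[OF reg(2) that \<open>t \<ge> 0\<close>]
    show ?thesis
      unfolding has_real_derivative_iff_has_vector_derivative[symmetric] F_def F'_def
      by (auto intro!: derivative_eq_intros simp: power2_eq_square algebra_simps)
  qed
  then have "(F' has_integral F 1 - F 0) {0..1}"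
    by (intro fundamental_theorem_of_calculus) auto
  moreover have "F 1 = 0" "F 0 = 0"
    using sol \<open>t \<ge> 0\<close> by (simp_all add: F_def is_solution_def)
  ultimately have flux: "(F' has_integral 0) {0..1}"
    by simp
  define D where "D x = u x t * partial_t u x t + B * \<theta> x t * partial_t \<theta> x t" for x
  define e where "e x = 1 / 2 * (u x t)\<^sup>2 + B / 2 * (\<theta> x t)\<^sup>2" for x
  have "(D has_integral integral {0..1} D) {0..1}"
    and e: "(e has_integral integral {0..1} e) {0..1}"
    unfolding D_def e_def
    by (intro integrable_integral integrable_continuous_real continuous_intros cont)+
  \<comment> \<open>Subtracting \<open>F'\<close>, which has integral zero, performs all
    integrations by parts at once: the second derivatives cancel in \<open>D x - F' x\<close>,
    leaving the expression that \<open>energy_density_estimate\<close> bounds pointwise.\<close>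
  then have "((\<lambda>x. D x - F' x) has_integral (integral {0..1} D - 0)) {0..1}"
    using flux by (intro has_integral_diff)
  then have "integral {0..1} D - 0 \<le> (B + 1) * (n + 1) / c * integral {0..1} e"
  proof (rule has_integral_le[OF _ has_integral_mult_right[OF e]])
    fix x :: real assume "x \<in> {0..1}"
    then have ut: "partial_t u x t =
          s * (n * partial_x (partial_x u) x t - \<alpha> * partial_x (partial_x \<theta>) x t)"
      and \<theta>t: "partial_t \<theta> x t = \<kappa> * partial_x (partial_x \<theta>) x t
          + s * ((n + 1) * u x t - \<alpha> * \<theta> x t)"
      using sol \<open>t \<ge> 0\<close> by (force simp: is_solution_def strip_def s_def)+
    have "D x - F' x = - s * n * (partial_x u x t)\<^sup>2 + s * \<alpha> * partial_x u x t * partial_x \<theta> x t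
        - B * \<kappa> * (partial_x \<theta> x t)\<^sup>2 + B * s * ((n + 1) * u x t - \<alpha> * \<theta> x t) * \<theta> x t"
      unfolding D_def F'_def ut \<theta>t by (simp add: algebra_simps power2_eq_square)
    also have "\<dots> \<le> (B + 1) * (n + 1) / c * e x"
      unfolding e_def by (rule energy_density_estimate[OF pos s B])
    finally show "D x - F' x \<le> (B + 1) * (n + 1) / c * e x" .
  qed
  then show ?thesis
    unfolding D_def e_def by simp
qed

theorem lemma3p3:
  fixes \<alpha> n \<kappa> \<theta>\<^sub>0 c\<^sub>0 :: real
  assumes "\<alpha> > 0" and "n > 0" and "\<kappa> > 0"
    and "c\<^sub>0 = exp (\<alpha> * \<theta>\<^sub>0)"
  shows "\<exists>B>0. \<exists>C\<^sub>B>0. \<forall>u \<theta>.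
    is_solution \<alpha> n \<kappa> c\<^sub>0 u \<theta> \<and> (\<forall>t\<ge>0. integral {0..1} (\<lambda>x. u x t) = 0) \<longrightarrow>
    (\<forall>t\<ge>0.
       integral {0..1} (\<lambda>x. 1 / 2 * (u x t)\<^sup>2 + B / 2 * (\<theta> x t)\<^sup>2)
       \<le> integral {0..1} (\<lambda>x. 1 / 2 * (u x 0)\<^sup>2 + B / 2 * (\<theta> x 0)\<^sup>2) * exp (C\<^sub>B * t))"
proof -
  have "c\<^sub>0 > 0"
    using assms(4) by simp
  \<comment> \<open>The smallest \<open>B\<close> for which the gradient condition
    \<open>\<alpha>\<^sup>2 / (4 * n * c\<^sub>0) \<le> B * \<kappa>\<close> holds, with equality.
    Both constants are fixed before any solution is introduced, hence are uniform in it.\<close>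
  define B where "B = \<alpha>\<^sup>2 / (4 * n * c\<^sub>0 * \<kappa>)"
  define C where "C = (B + 1) * (n + 1) / c\<^sub>0"
  have B: "B > 0" "\<alpha>\<^sup>2 / (4 * n * c\<^sub>0) \<le> B * \<kappa>"
    unfolding B_def using assms(1-3) \<open>c\<^sub>0 > 0\<close> by auto
  have "C > 0"
    unfolding C_def using assms(2) \<open>c\<^sub>0 > 0\<close> B(1) by (intro divide_pos_pos mult_pos_pos) auto
  have "integral {0..1} (\<lambda>x. 1 / 2 * (u x t)\<^sup>2 + B / 2 * (\<theta> x t)\<^sup>2)
      \<le> integral {0..1} (\<lambda>x. 1 / 2 * (u x 0)\<^sup>2 + B / 2 * (\<theta> x 0)\<^sup>2) * exp (C * t)"
    if sol: "is_solution \<alpha> n \<kappa> c\<^sub>0 u \<theta>" and "t \<ge> 0" for u \<theta> t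
  proof -
    have reg: "classical_regularity u" "classical_regularity \<theta>"
      using sol by (auto simp: is_solution_def)
    show ?thesis
      using gronwall_differential[OF energy_has_derivative[OF reg]
          energy_derivative_bound[OF assms(1,2) \<open>c\<^sub>0 > 0\<close> B sol] \<open>t \<ge> 0\<close>]
      by (simp add: C_def)
  qed
  with B(1) \<open>C > 0\<close> show ?thesis
    by blast
qed

end
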